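(* Let $g:(-1,1)\to\mathbb{R}$ be a link function, and assume that the random vector $(B,A_1,\dots,A_p)$ with entries in $\{-1,1\}$ takes $2^{p+1}$ distinct values with positive probability. Let $\bm{A}=(A_1,\dots,A_p)^\top$. Then there exist unique vectors $\bm{\gamma},\bm{\beta}\in\mathbb{R}^{2^p}$ such that $\mathbf{E}[B\mid\bm{A}]=g^{-1}(\bm{\gamma}^\top\bm{A}^{\otimes})=\bm{\beta}^\top\bm{A}^{\otimes}$.
   Context: For $\bm{A}\in\{-1,1\}^p$, $\bm{A}^{\otimes}=\begin{pmatrix}1\\ A_1\end{pmatrix}\otimes\cdots\otimes\begin{pmatrix}1\\ A_p\end{pmatrix}\in\{-1,1\}^{2^p}$ is the vector of all products $\prod_{j\in\Lambda}A_j$, $\Lambda\subseteq\{1,\dots,p\}$. A link function here is an injective function $g:(-1,1)\to\mathbb{R}$, and $g^{-1}$ is its inverse, defined on the range of $g$; the equality $\mathbf{E}[B\mid\bm{A}]=g^{-1}(\bm{\gamma}^\top\bm{A}^{\otimes})$ includes the requirement that $\bm{\gamma}^\top\bm{A}^{\otimes}$ lie in the range of $g$. *)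

theory Defs
  imports "HOL-Probability.Probability" "Jordan_Normal_Form.Matrix"
begin

text \<open>Both libraries have a constant \<open>vec\<close> and a notation for indexing; below they are those of
  \<^theory>\<open>Jordan_Normal_Form.Matrix\<close>, whose vectors have a length that is a number rather than
  a type.\<close>

hide_const (open) Finite_Cartesian_Product.vec
unbundle no vec_syntax
unbundle no inner_syntax

definition kron_vec :: "real vec \<Rightarrow> real vec \<Rightarrow> real vec" where
  "kron_vec u v =
     vec (dim_vec u * dim_vec v) (\<lambda>i. u $ (i div dim_vec v) * v $ (i mod dim_vec v))"

text \<open>\<open>(1, a 1) \<otimes> \<dots> \<otimes> (1, a p)\<close>, a vector of length \<open>2 ^ p\<close>; the empty Kronecker product is
  the vector \<open>(1)\<close>.\<close>

primrec otimes_vec :: "nat \<Rightarrow> (nat \<Rightarrow> real) \<Rightarrow> real vec" where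
  "otimes_vec 0 a = vec_of_list [1]"
| "otimes_vec (Suc p) a = kron_vec (otimes_vec p a) (vec_of_list [1, a (Suc p)])"

lemma otimes_vec_carrier: "otimes_vec p a \<in> carrier_vec (2 ^ p)"
  by (rule carrier_vecI, induction p) (simp_all only: otimes_vec.simps kron_vec_def dim_vec
    dim_vec_of_list list.size power_0 power_Suc2 One_nat_def plus_nat.simps numeral_2_eq_2)

text \<open>The sigma-algebra generated by the random vector \<open>(A 1, \<dots>, A p)\<close>.\<close>

definition sigma_gen :: "'a measure \<Rightarrow> nat \<Rightarrow> (nat \<Rightarrow> 'a \<Rightarrow> real) \<Rightarrow> 'a measure" where
  "sigma_gen M p A =
     vimage_algebra (space M) (\<lambda>x. \<lambda>i\<in>{1..p}. A i x) (Pi\<^sub>M {1..p} (\<lambda>_. borel))"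

end

theory Submission
  imports Defs
begin

text \<open>Splitting off the last factor of the Kronecker product gives
  \<open>c \<bullet> A\<^sup>\<otimes> = c\<^sub>0 \<bullet> A'\<^sup>\<otimes> + A\<^sub>p (c\<^sub>1 \<bullet> A'\<^sup>\<otimes>)\<close>, where \<open>c\<^sub>0\<close> and \<open>c\<^sub>1\<close> are the entries of \<open>c\<close> with even
  and odd index. Solving for \<open>c\<^sub>0\<close> and \<open>c\<^sub>1\<close> at \<open>A\<^sub>p = \<plusminus>1\<close> shows by induction that each real function
  on \<open>{-1, 1}\<^sup>p\<close> is \<open>a \<mapsto> c \<bullet> a\<^sup>\<otimes>\<close> for exactly one \<open>c\<close>. The positivity assumption makes each of the
  \<open>2\<^sup>p\<^sup>+\<^sup>1\<close> cells have positive mass, so \<open>E[B | A = a]\<close> lies in \<open>(-1, 1)\<close>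
  and an almost sure identity in \<open>A\<close> holds at every point of the cube. It remains to
  interpolate \<open>a \<mapsto> E[B | A = a]\<close> and its image under \<open>g\<close>.\<close>

section \<open>Linear algebra: Kronecker coordinates of functions on the sign cube\<close>

abbreviation sign_cube :: "nat \<Rightarrow> (nat \<Rightarrow> real) set" where
  "sign_cube p \<equiv> {1..p} \<rightarrow>\<^sub>E {-1, 1}"

lemma sum_pairs:
  fixes f :: "nat \<Rightarrow> 'a::comm_monoid_add"
  shows "(\<Sum>i = 0..<n * 2. f i) = (\<Sum>j = 0..<n. f (2 * j) + f (2 * j + 1))"
  by (induction n) (simp_all add: add.assoc mult.commute)

text \<open>The factor \<open>[s, t]\<close> varies fastest: entry \<open>2 * j\<close> of the
  product is \<open>u $ j * s\<close> and entry \<open>2 * j + 1\<close> is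
  \<open>u $ j * t\<close>, so the sum splits by parity of the index.\<close>

lemma scalar_prod_kron_pair:
  assumes "dim_vec u = n"
  shows "c \<bullet> kron_vec u (vec_of_list [s, t]) =
    s * (vec n (\<lambda>j. c $ (2 * j)) \<bullet> u) + t * (vec n (\<lambda>j. c $ (2 * j + 1)) \<bullet> u)"
proof -
  have "c \<bullet> kron_vec u (vec_of_list [s, t]) =
      (\<Sum>i = 0..<n * 2. c $ i * (u $ (i div 2) * vec_of_list [s, t] $ (i mod 2)))"
    using assms by (simp add: scalar_prod_def kron_vec_def numeral_2_eq_2 mult.commute del: vec_of_list_Cons mult_Suc_right)
  also have "\<dots> = (\<Sum>j = 0..<n. s * (c $ (2 * j) * u $ j) + t * (c $ (2 * j + 1) * u $ j))"
    unfolding sum_pairs by (intro sum.cong refl) (simp, algebra)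
  also have "\<dots> = s * (vec n (\<lambda>j. c $ (2 * j)) \<bullet> u) + t * (vec n (\<lambda>j. c $ (2 * j + 1)) \<bullet> u)"
    using assms by (simp add: scalar_prod_def sum.distrib sum_distrib_left)
  finally show ?thesis .
qed

lemma dim_otimes_vec: "dim_vec (otimes_vec p a) = 2 ^ p"
  using otimes_vec_carrier by auto

lemma otimes_vec_cong:
  assumes "\<And>i. i \<in> {1..p} \<Longrightarrow> a i = b i"
  shows "otimes_vec p a = otimes_vec p b"
  using assms by (induction p) auto

lemma otimes_vec_upd: "otimes_vec p (a(Suc p := t)) = otimes_vec p a"
  by (rule otimes_vec_cong) auto

lemma scalar_prod_otimes_Suc:
  "c \<bullet> otimes_vec (Suc p) a =
    vec (2 ^ p) (\<lambda>j. c $ (2 * j)) \<bullet> otimes_vec p a +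
    a (Suc p) * (vec (2 ^ p) (\<lambda>j. c $ (2 * j + 1)) \<bullet> otimes_vec p a)"
  using scalar_prod_kron_pair[OF dim_otimes_vec, of c p a 1 "a (Suc p)"] by simp

lemma sign_cube_upd:
  assumes "a \<in> sign_cube p" "t \<in> {-1, 1}"
  shows "a(Suc p := t) \<in> sign_cube (Suc p)"
  using assms by (auto simp: PiE_iff extensional_def le_Suc_eq)

lemma otimes_vec_eqI:
  assumes "c \<in> carrier_vec (2 ^ p)" "d \<in> carrier_vec (2 ^ p)"
    and "\<And>a. a \<in> sign_cube p \<Longrightarrow> c \<bullet> otimes_vec p a = d \<bullet> otimes_vec p a"
  shows "c = d"
  using assms
proof (induction p arbitrary: c d)
  case 0
  then show ?case by (auto simp: scalar_prod_def intro!: eq_vecI)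
next
  case (Suc p)
  let ?even = "\<lambda>c. vec (2 ^ p) (\<lambda>j. c $ (2 * j)) :: real vec"
  let ?odd = "\<lambda>c. vec (2 ^ p) (\<lambda>j. c $ (2 * j + 1)) :: real vec"
  have split: "?even c \<bullet> otimes_vec p a + t * (?odd c \<bullet> otimes_vec p a) =
      ?even d \<bullet> otimes_vec p a + t * (?odd d \<bullet> otimes_vec p a)"
    if "a \<in> sign_cube p" "t \<in> {-1, 1}" for a t
    using Suc.prems(3)[OF sign_cube_upd[OF that]]
    by (simp only: scalar_prod_otimes_Suc otimes_vec_upd fun_upd_same)
  \<comment> \<open>Adding and subtracting the identities for \<open>t = 1\<close> and
    \<open>t = -1\<close> isolates the even and the odd part.\<close>
  have "?even c \<bullet> otimes_vec p a = ?even d \<bullet> otimes_vec p a"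
    "?odd c \<bullet> otimes_vec p a = ?odd d \<bullet> otimes_vec p a" if "a \<in> sign_cube p" for a
    using split[OF that, of 1] split[OF that, of "-1"] by simp_all
  then have eqs: "?even c = ?even d" "?odd c = ?odd d"
    by (auto intro!: Suc.IH)
  show "c = d"
  proof (rule eq_vecI)
    show "dim_vec c = dim_vec d" using Suc.prems by auto
    fix i assume "i < dim_vec d"
    then have i: "i div 2 < 2 ^ p" using Suc.prems by auto
    have "?even c $ (i div 2) = ?even d $ (i div 2)" "?odd c $ (i div 2) = ?odd d $ (i div 2)"
      using eqs by simp_all
    then have "c $ (2 * (i div 2)) = d $ (2 * (i div 2))"
      "c $ (2 * (i div 2) + 1) = d $ (2 * (i div 2) + 1)"
      using i by simp_all
    then show "c $ i = d $ i"
      by (cases "even i") (metis dvd_mult_div_cancel, metis odd_two_times_div_two_succ)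
  qed
qed

lemma otimes_vec_interpolation:
  "\<exists>c \<in> carrier_vec (2 ^ p). \<forall>a \<in> sign_cube p. c \<bullet> otimes_vec p a = f a"
proof (induction p arbitrary: f)
  case 0
  show ?case
    \<comment> \<open>\<open>sign_cube 0\<close> has the single element
      \<open>\<lambda>_. undefined\<close>, so only the value of \<open>f\<close> there has to be
      matched.\<close>
    by (rule bexI[of _ "vec 1 (\<lambda>_. f (\<lambda>_. undefined))"]) (auto simp: scalar_prod_def)
next
  case (Suc p)
  let ?f = "\<lambda>t a. f (a(Suc p := t))"
  \<comment> \<open>Half-sum and half-difference solve \<open>u + v = ?f 1\<close> and
    \<open>u - v = ?f (-1)\<close>; interleaving them gives \<open>c\<close>.\<close>
  obtain u where u: "u \<in> carrier_vec (2 ^ p)"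
    "\<And>a. a \<in> sign_cube p \<Longrightarrow> u \<bullet> otimes_vec p a = (?f 1 a + ?f (-1) a) / 2"
    using Suc.IH[of "\<lambda>a. (?f 1 a + ?f (-1) a) / 2"] by auto
  obtain v where v: "v \<in> carrier_vec (2 ^ p)"
    "\<And>a. a \<in> sign_cube p \<Longrightarrow> v \<bullet> otimes_vec p a = (?f 1 a - ?f (-1) a) / 2"
    using Suc.IH[of "\<lambda>a. (?f 1 a - ?f (-1) a) / 2"] by auto
  define c where "c = vec (2 ^ Suc p) (\<lambda>i. if even i then u $ (i div 2) else v $ (i div 2))"
  have c: "vec (2 ^ p) (\<lambda>j. c $ (2 * j)) = u" "vec (2 ^ p) (\<lambda>j. c $ (2 * j + 1)) = v"
    using u v by (auto simp: c_def intro!: eq_vecI)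
  show ?case
  proof (intro bexI[of _ c] ballI)
    fix a assume a: "a \<in> sign_cube (Suc p)"
    \<comment> \<open>Restriction makes \<open>b\<close> extensional on \<open>{1..p}\<close>, as
      membership in \<open>sign_cube p\<close> demands; updating at \<open>Suc p\<close> recovers
      \<open>a\<close>.\<close>
    define b where "b = restrict a {1..p}"
    have b: "b \<in> sign_cube p" "a = b(Suc p := a (Suc p))"
      using a by (auto simp: b_def PiE_iff extensional_def fun_eq_iff not_le le_Suc_eq)
    have "otimes_vec p a = otimes_vec p b"
      by (rule otimes_vec_cong) (simp add: b_def)
    then have eq: "c \<bullet> otimes_vec (Suc p) a =
        (?f 1 b + ?f (-1) b) / 2 + a (Suc p) * ((?f 1 b - ?f (-1) b) / 2)"
      unfolding scalar_prod_otimes_Suc c by (simp only: u(2)[OF b(1)] v(2)[OF b(1)])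
    have "a (Suc p) \<in> {-1, 1}" using a by (auto simp: PiE_iff)
    then have "c \<bullet> otimes_vec (Suc p) a = ?f (a (Suc p)) b"
      unfolding eq by (auto simp: field_simps)
    then show "c \<bullet> otimes_vec (Suc p) a = f a" using b(2) by simp
  qed (simp add: c_def)
qed

section \<open>The random signs and the cells of their joint distribution\<close>

locale sign_vector = prob_space M for M :: "'a measure" +
  fixes p :: nat and B :: "'a \<Rightarrow> real" and A :: "nat \<Rightarrow> 'a \<Rightarrow> real"
  assumes B_meas [measurable]: "B \<in> borel_measurable M"
    and A_meas [measurable]: "\<And>i. i \<in> {1..p} \<Longrightarrow> A i \<in> borel_measurable M"
    and B_sign: "\<And>x. x \<in> space M \<Longrightarrow> B x \<in> {-1, 1}"
    and A_sign: "\<And>i x. i \<in> {1..p} \<Longrightarrow> x \<in> space M \<Longrightarrow> A i x \<in> {-1, 1}"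
    and card_cells:
      "card {(b, a). measure M {x \<in> space M. B x = b \<and> (\<lambda>i\<in>{1..p}. A i x) = a} > 0} = 2 ^ (p + 1)"
begin

definition cell :: "real \<Rightarrow> (nat \<Rightarrow> real) \<Rightarrow> 'a set" where
  "cell b a = {x \<in> space M. B x = b \<and> (\<lambda>i\<in>{1..p}. A i x) = a}"

abbreviation vecA :: "'a \<Rightarrow> nat \<Rightarrow> real" where
  "vecA x \<equiv> (\<lambda>i\<in>{1..p}. A i x)"

lemma vecA_mem: "x \<in> space M \<Longrightarrow> vecA x \<in> sign_cube p"
  using A_sign by auto

lemma finite_sign_cube: "finite (sign_cube p)"
  by (intro finite_PiE) auto

lemma otimes_vecA: "otimes_vec p (vecA x) = otimes_vec p (\<lambda>i. A i x)"
  by (rule otimes_vec_cong) simp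

text \<open>A cell of positive mass is nonempty, so its label lies in \<open>?T\<close>. This set
  has exactly \<open>2 ^ (p + 1)\<close> elements, and the assumed count leaves none of them
  out.\<close>

lemma measure_cell_pos:
  assumes "b \<in> {-1, 1}" "a \<in> sign_cube p"
  shows "measure M (cell b a) > 0"
proof -
  let ?S = "{(b, a). measure M (cell b a) > 0}" and ?T = "{-1, 1 :: real} \<times> sign_cube p"
  have "?S \<subseteq> ?T"
  proof clarify
    fix b a assume "measure M (cell b a) > 0"
    then have "cell b a \<noteq> {}" by auto
    then obtain x where "x \<in> space M" "B x = b" "vecA x = a" by (auto simp: cell_def)
    then show "b \<in> {-1, 1} \<and> a \<in> sign_cube p" using B_sign vecA_mem by blast
  qed
  moreover have "card {-1, 1 :: real} = 2" by simp
  then have "card ?S = card ?T"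
    using card_cells
    by (simp only: cell_def card_cartesian_product card_PiE[OF finite_atLeastAtMost] prod_constant
        card_atLeastAtMost diff_Suc_1 power_add power_one_right mult.commute)
  moreover have "finite ?T" using finite_sign_cube by simp
  ultimately have "?S = ?T" by (simp add: card_subset_eq)
  then show ?thesis using assms by blast
qed

lemma vecA_measurable: "vecA \<in> measurable M (Pi\<^sub>M {1..p} (\<lambda>_. borel))"
  by (rule measurable_restrict) simp

text \<open>Since \<open>a\<close> is extensional, its singleton is a finite box of one-point
  sets.\<close>

lemma singleton_sets_PiM:
  assumes "a \<in> sign_cube p"
  shows "{a} \<in> sets (Pi\<^sub>M {1..p} (\<lambda>_. borel :: real measure))"
proof -
  have "{a} = (\<Pi>\<^sub>E i\<in>{1..p}. {a i})"
    using assms by (intro PiE_singleton[symmetric]) (auto simp: PiE_iff)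
  then show ?thesis by (simp add: sets_PiM_I_finite)
qed

lemma cell_sets [measurable]:
  assumes "a \<in> sign_cube p"
  shows "cell b a \<in> sets M"
proof -
  have "cell b a = (B -` {b} \<inter> space M) \<inter> (vecA -` {a} \<inter> space M)"
    by (auto simp: cell_def)
  then show ?thesis
    using measurable_sets[OF B_meas, of "{b}"]
      measurable_sets[OF vecA_measurable singleton_sets_PiM[OF assms]]
    by simp
qed

text \<open>Each \<open>x\<close> lies in exactly one cell, so one term survives. This writes any
  function of the signs as a combination of cell indicators, and integrals become finite
  sums.\<close>

lemma sum_cells:
  assumes "x \<in> space M"
  shows "(\<Sum>a\<in>sign_cube p. \<phi> 1 a * indicator (cell 1 a) x + \<phi> (-1) a * indicator (cell (-1) a) x)
    = (\<phi> (B x) (vecA x) :: real)"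
proof -
  have "(\<Sum>a\<in>sign_cube p. \<phi> 1 a * indicator (cell 1 a) x + \<phi> (-1) a * indicator (cell (-1) a) x)
     = (\<Sum>a\<in>sign_cube p. if a = vecA x then \<phi> (B x) a else 0)"
    using assms B_sign[OF assms] by (intro sum.cong refl) (auto simp: cell_def)
  then show ?thesis using vecA_mem[OF assms] finite_sign_cube by simp
qed

lemma cell_integral:
  assumes "\<And>x. x \<in> space M \<Longrightarrow> F x = \<phi> (B x) (vecA x)"
  shows "integrable M F"
    and "(\<integral>x. F x \<partial>M) =
      (\<Sum>a\<in>sign_cube p. \<phi> 1 a * measure M (cell 1 a) + \<phi> (-1) a * measure M (cell (-1) a))"
proof -
  let ?G = "\<lambda>x. \<Sum>a\<in>sign_cube p. \<phi> 1 a * indicator (cell 1 a) x + \<phi> (-1) a * indicator (cell (-1) a) x"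
  have FG: "F x = ?G x" if "x \<in> space M" for x
    using assms[OF that] sum_cells[OF that] by simp
  have int: "integrable M (\<lambda>x. k * indicator (cell b a) x :: real)" if "a \<in> sign_cube p" for k b a
    using cell_sets[OF that] by (intro integrable_mult_right integrable_real_indicator) (auto simp: emeasure_eq_measure)
  have "integrable M ?G"
    by (intro Bochner_Integration.integrable_sum Bochner_Integration.integrable_add int)
  then show "integrable M F"
    using FG by (simp cong: Bochner_Integration.integrable_cong)
  have "(\<integral>x. F x \<partial>M) = (\<integral>x. ?G x \<partial>M)"
    by (rule Bochner_Integration.integral_cong) (simp_all add: FG)
  also have "\<dots> = (\<Sum>a\<in>sign_cube p. (\<integral>x. \<phi> 1 a * indicator (cell 1 a) x \<partial>M)
      + (\<integral>x. \<phi> (-1) a * indicator (cell (-1) a) x \<partial>M))"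
    by (subst Bochner_Integration.integral_sum)
      (intro Bochner_Integration.integrable_add int sum.cong refl
        Bochner_Integration.integral_add; assumption)+
  also have "\<dots> = (\<Sum>a\<in>sign_cube p. \<phi> 1 a * measure M (cell 1 a) + \<phi> (-1) a * measure M (cell (-1) a))"
    by (intro sum.cong refl) (simp add: cell_def Int_absorb2 subset_iff)
  finally show "(\<integral>x. F x \<partial>M) =
      (\<Sum>a\<in>sign_cube p. \<phi> 1 a * measure M (cell 1 a) + \<phi> (-1) a * measure M (cell (-1) a))" .
qed

text \<open>The value of \<open>E[B | A]\<close> on the event \<open>A = a\<close>.\<close>

definition mean :: "(nat \<Rightarrow> real) \<Rightarrow> real" where
  "mean a = (measure M (cell 1 a) - measure M (cell (-1) a))
    / (measure M (cell 1 a) + measure M (cell (-1) a))"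

text \<open>The two sides are the integrals of \<open>mean a\<close> and of \<open>B\<close> over
  the event that \<open>vecA\<close> equals \<open>a\<close>; positive cell masses allow clearing
  the denominator.\<close>

lemma mean_balance:
  assumes "a \<in> sign_cube p"
  shows "mean a * measure M (cell 1 a) + mean a * measure M (cell (-1) a)
    = measure M (cell 1 a) - measure M (cell (-1) a)"
proof -
  have "measure M (cell 1 a) + measure M (cell (-1) a) \<noteq> 0"
    using measure_cell_pos[of 1 a] measure_cell_pos[of "-1" a] assms by simp
  then show ?thesis by (simp only: mean_def flip: distrib_left) simp
qed

text \<open>Both masses are positive, so their difference is strictly smaller in absolute value than
  their sum. This puts \<open>mean a\<close> in the domain of the link function.\<close>

lemma mean_mem:
  assumes "a \<in> sign_cube p"
  shows "mean a \<in> {-1<..<1}"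
  using measure_cell_pos[of 1 a] measure_cell_pos[of "-1" a] assms
  by (simp add: mean_def field_simps)

section \<open>The generated sigma-algebra and the conditional expectation\<close>

lemma space_sigma_gen: "space (sigma_gen M p A) = space M"
  by (simp add: sigma_gen_def)

lemma vecA_measurable_sigma_gen: "vecA \<in> measurable (sigma_gen M p A) (Pi\<^sub>M {1..p} (\<lambda>_. borel))"
  unfolding sigma_gen_def
  by (rule measurable_vimage_algebra1) (auto simp: space_PiM)

lemma sets_sigma_gen:
  "sets (sigma_gen M p A) = {vecA -` T \<inter> space M | T. T \<in> sets (Pi\<^sub>M {1..p} (\<lambda>_. borel))}"
  unfolding sigma_gen_def by (rule sets_vimage_algebra2) (auto simp: space_PiM)

lemma subalgebra_sigma_gen: "subalgebra M (sigma_gen M p A)"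
  using measurable_sets[OF vecA_measurable]
  by (auto simp: subalgebra_def space_sigma_gen sets_sigma_gen)

text \<open>The cube is finite with measurable points, so a function of \<open>vecA\<close> is a
  finite sum of multiples of indicators.\<close>

lemma vecA_function_measurable:
  fixes f :: "(nat \<Rightarrow> real) \<Rightarrow> real"
  shows "(\<lambda>x. f (vecA x)) \<in> borel_measurable (sigma_gen M p A)"
proof -
  have "(\<lambda>x. \<Sum>a\<in>sign_cube p. f a * indicator (vecA -` {a} \<inter> space (sigma_gen M p A)) x)
      \<in> borel_measurable (sigma_gen M p A)"
    using measurable_sets[OF vecA_measurable_sigma_gen singleton_sets_PiM]
    by (intro borel_measurable_sum borel_measurable_times borel_measurable_indicator) auto
  moreover have "(\<Sum>a\<in>sign_cube p. f a * indicator (vecA -` {a} \<inter> space (sigma_gen M p A)) x)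
      = f (vecA x)" if "x \<in> space (sigma_gen M p A)" for x
  proof -
    have "(\<Sum>a\<in>sign_cube p. f a * indicator (vecA -` {a} \<inter> space (sigma_gen M p A)) x)
       = (\<Sum>a\<in>sign_cube p. if a = vecA x then f a else 0)"
      using that by (intro sum.cong refl) auto
    then show ?thesis
      using vecA_mem that finite_sign_cube by (simp add: space_sigma_gen)
  qed
  ultimately show ?thesis by (subst measurable_cong[symmetric]) auto
qed

text \<open>By the characterization of conditional expectation it suffices to compare integrals over
  events generated by \<open>A\<close>. Both become sums over the cube and agree term by term by
  \<open>mean_balance\<close>.\<close>

lemma cond_exp_eq_mean:
  "AE x in M. real_cond_exp M (sigma_gen M p A) B x = mean (vecA x)"
proof -
  interpret sub: finite_measure_subalgebra M "sigma_gen M p A"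
    by unfold_locales (rule subalgebra_sigma_gen)
  show ?thesis
  proof (rule sub.real_cond_exp_charact)
    show "integrable M B" by (rule cell_integral(1)[of B "\<lambda>b a. b"]) simp
    show "integrable M (\<lambda>x. mean (vecA x))" by (rule cell_integral(1)[of _ "\<lambda>b. mean"]) simp
    show "(\<lambda>x. mean (vecA x)) \<in> borel_measurable (sigma_gen M p A)"
      by (rule vecA_function_measurable)
  next
    fix G assume "G \<in> sets (sigma_gen M p A)"
    then obtain T where G: "G = vecA -` T \<inter> space M" by (auto simp: sets_sigma_gen)
    have "(\<integral>x\<in>G. B x \<partial>M) = (\<Sum>a\<in>sign_cube p.
        indicator T a * measure M (cell 1 a) + - indicator T a * measure M (cell (-1) a))"
      unfolding set_lebesgue_integral_def
      by (subst cell_integral(2)[where \<phi> = "\<lambda>b a. indicator T a * b"])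
        (auto simp: G split: split_indicator)
    also have "\<dots> = (\<Sum>a\<in>sign_cube p. indicator T a * mean a * measure M (cell 1 a)
        + indicator T a * mean a * measure M (cell (-1) a))"
      using mean_balance by (intro sum.cong refl) (simp add: mult.assoc split: split_indicator)
    also have "\<dots> = (\<integral>x\<in>G. mean (vecA x) \<partial>M)"
      unfolding set_lebesgue_integral_def
      by (subst cell_integral(2)[where \<phi> = "\<lambda>b a. indicator T a * mean a"])
        (auto simp: G split: split_indicator)
    finally show "(\<integral>x\<in>G. B x \<partial>M) = (\<integral>x\<in>G. mean (vecA x) \<partial>M)" .
  qed
qed

text \<open>A cell of positive mass cannot lie in a null set; the cell with \<open>b = 1\<close>
  supplies the witness. Almost sure identities thus hold at each point of the cube.\<close>

lemma AE_cell_witness: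
  assumes "AE x in M. P x" "a \<in> sign_cube p"
  obtains x where "x \<in> space M" "vecA x = a" "P x"
proof -
  have "\<exists>x \<in> cell 1 a. P x"
  proof (rule ccontr)
    assume "\<not> ?thesis"
    with assms(1) have "AE x in M. x \<notin> cell 1 a" by (auto elim: eventually_mono)
    then have "measure M (cell 1 a) = 0"
      using cell_sets[OF assms(2)] by (simp add: AE_iff_measurable[OF _ refl] prob_eq_0)
    with measure_cell_pos[of 1 a] assms(2) show False by simp
  qed
  then show ?thesis using that by (auto simp: cell_def)
qed

end

section \<open>Existence and uniqueness of the two coefficient vectors\<close>

theorem theorem4p1:
  fixes M :: "'a measure" and p :: nat
    and B :: "'a \<Rightarrow> real" and A :: "nat \<Rightarrow> 'a \<Rightarrow> real" and g :: "real \<Rightarrow> real"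
  assumes "inj_on g {-1<..<1}"
    and "prob_space M"
    and "B \<in> borel_measurable M"
    and "\<And>i. i \<in> {1..p} \<Longrightarrow> A i \<in> borel_measurable M"
    and "\<And>x. x \<in> space M \<Longrightarrow> B x \<in> {-1, 1}"
    and "\<And>i x. i \<in> {1..p} \<Longrightarrow> x \<in> space M \<Longrightarrow> A i x \<in> {-1, 1}"
    and "card {(b, a). measure M {x \<in> space M. B x = b \<and> (\<lambda>i\<in>{1..p}. A i x) = a} > 0}
           = 2 ^ (p + 1)"
  shows "\<exists>!(\<gamma>\<beta> :: real vec \<times> real vec). case \<gamma>\<beta> of (\<gamma>, \<beta>) \<Rightarrow>
           \<gamma> \<in> carrier_vec (2 ^ p) \<and> \<beta> \<in> carrier_vec (2 ^ p) \<and>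
           (AE x in M.
              \<gamma> \<bullet> otimes_vec p (\<lambda>i. A i x) \<in> g ` {-1<..<1} \<and>
              real_cond_exp M (sigma_gen M p A) B x
                = inv_into {-1<..<1} g (\<gamma> \<bullet> otimes_vec p (\<lambda>i. A i x)) \<and>
              inv_into {-1<..<1} g (\<gamma> \<bullet> otimes_vec p (\<lambda>i. A i x))
                = \<beta> \<bullet> otimes_vec p (\<lambda>i. A i x))"
proof -
  interpret sign_vector M p B A
    using assms(2-7) unfolding sign_vector_def sign_vector_axioms_def by blast
  let ?V = "\<lambda>x. otimes_vec p (\<lambda>i. A i x)"
  let ?E = "real_cond_exp M (sigma_gen M p A) B"
  let ?ginv = "inv_into {-1<..<1} g"
  obtain \<gamma> where \<gamma>: "\<gamma> \<in> carrier_vec (2 ^ p)"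
    "\<And>a. a \<in> sign_cube p \<Longrightarrow> \<gamma> \<bullet> otimes_vec p a = g (mean a)"
    using otimes_vec_interpolation[of p "\<lambda>a. g (mean a)"] by auto
  obtain \<beta> where \<beta>: "\<beta> \<in> carrier_vec (2 ^ p)"
    "\<And>a. a \<in> sign_cube p \<Longrightarrow> \<beta> \<bullet> otimes_vec p a = mean a"
    using otimes_vec_interpolation[of p mean] by auto
  show ?thesis
  proof (rule ex1I[of _ "(\<gamma>, \<beta>)"], unfold prod.case, intro conjI \<gamma>(1) \<beta>(1))
    show "AE x in M. \<gamma> \<bullet> ?V x \<in> g ` {-1<..<1} \<and> ?E x = ?ginv (\<gamma> \<bullet> ?V x)
        \<and> ?ginv (\<gamma> \<bullet> ?V x) = \<beta> \<bullet> ?V x"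
      using cond_exp_eq_mean AE_space
    proof eventually_elim
      case (elim x)
      then have a: "vecA x \<in> sign_cube p" using vecA_mem by blast
      \<comment> \<open>The value \<open>g (mean a)\<close> is in the range because
        \<open>mean a\<close> is in \<open>(-1, 1)\<close>, and injectivity lets
        \<open>?ginv\<close> return \<open>mean a\<close>.\<close>
      show ?case
        using \<gamma>(2)[OF a] \<beta>(2)[OF a] elim mean_mem[OF a] assms(1)
        by (simp only: otimes_vecA inv_into_f_f imageI simp_thms)
    qed
  next
    fix \<gamma>\<beta>' :: "real vec \<times> real vec"
    assume "case \<gamma>\<beta>' of (\<gamma>', \<beta>') \<Rightarrow> \<gamma>' \<in> carrier_vec (2 ^ p) \<and> \<beta>' \<in> carrier_vec (2 ^ p) \<and>
      (AE x in M. \<gamma>' \<bullet> ?V x \<in> g ` {-1<..<1} \<and> ?E x = ?ginv (\<gamma>' \<bullet> ?V x)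
        \<and> ?ginv (\<gamma>' \<bullet> ?V x) = \<beta>' \<bullet> ?V x)"
    then obtain \<gamma>' \<beta>' where \<gamma>\<beta>': "\<gamma>\<beta>' = (\<gamma>', \<beta>')"
      and car: "\<gamma>' \<in> carrier_vec (2 ^ p)" "\<beta>' \<in> carrier_vec (2 ^ p)"
      and ae: "AE x in M. \<gamma>' \<bullet> ?V x \<in> g ` {-1<..<1} \<and> ?E x = ?ginv (\<gamma>' \<bullet> ?V x)
        \<and> ?ginv (\<gamma>' \<bullet> ?V x) = \<beta>' \<bullet> ?V x"
      by auto
    \<comment> \<open>Agreement on the whole cube suffices, by
      \<open>otimes_vec_eqI\<close>.\<close>
    have "\<gamma>' \<bullet> otimes_vec p a = \<gamma> \<bullet> otimes_vec p a \<and> \<beta>' \<bullet> otimes_vec p a = \<beta> \<bullet> otimes_vec p a"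
      if a: "a \<in> sign_cube p" for a
    proof -
      from ae cond_exp_eq_mean have "AE x in M. \<gamma>' \<bullet> ?V x \<in> g ` {-1<..<1} \<and>
          mean (vecA x) = ?ginv (\<gamma>' \<bullet> ?V x) \<and> mean (vecA x) = \<beta>' \<bullet> ?V x"
        by eventually_elim auto
      from AE_cell_witness[OF this a]
      obtain x where x: "vecA x = a" "\<gamma>' \<bullet> ?V x \<in> g ` {-1<..<1}"
          "mean (vecA x) = ?ginv (\<gamma>' \<bullet> ?V x)" "mean (vecA x) = \<beta>' \<bullet> ?V x"
        by blast
      have V: "?V x = otimes_vec p a" using otimes_vecA[of x] x(1) by simp
      \<comment> \<open>Range membership is essential here: outside the image
        \<open>inv_into\<close> is unspecified, and applying \<open>g\<close> would not recover the
        value of the scalar product.\<close>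
      from f_inv_into_f[OF x(2)] have "\<gamma>' \<bullet> otimes_vec p a = g (mean a)"
        using x(1,3) V by simp
      then show ?thesis using x(1,4) V \<gamma>(2)[OF a] \<beta>(2)[OF a] by simp
    qed
    then have "\<gamma>' = \<gamma>" "\<beta>' = \<beta>"
      by (auto intro!: otimes_vec_eqI[of _ p] car \<gamma>(1) \<beta>(1))
    then show "\<gamma>\<beta>' = (\<gamma>, \<beta>)" by (simp add: \<gamma>\<beta>')
  qed
qed

end
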